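(* Let $n\ge 1$ and $d\ge 1$ be integers. There are constants $\xi>0$ and $M>0$, depending only on $n$ and $d$, such that the following holds. Let $s>0$, $h>0$, and let $Z\subset Q^n_s=[0,s]^n$ be a finite $h$-dense set with $Z\subset\hat B^n$. If $h\le \xi s^{n(d+1)}$, then $$\mathcal{RG}_d(Z)\ge M>0 .$$
   Context: $B^n\subset\mathbb{R}^n$ is the closed unit ball and $\hat B^n$ is the concentric closed ball of radius $\frac13$. For a $C^{d+1}$-smooth function $f:B^n\to\mathbb{R}$ and $0\le l\le d+1$, put $M_l(f)=\max_{z\in B^n}\|f^{(l)}(z)\|$, where $\|f^{(l)}(z)\|$ is the maximum of the absolute values of all partial derivatives of $f$ of order $l$ at $z$. For $Z\subset\hat B^n$, let $U_d(Z)$ be the set of all $C^{d+1}$-smooth functions $f:B^n\to\mathbb{R}$ vanishing on $Z$ with $M_0(f)=1$. The $d$-rigidity of $Z$ is $\mathcal{RG}_d(Z)=\inf_{f\in U_d(Z)}M_{d+1}(f)$. A finite set $Z$ inside the cube $Q^n_s=[0,s]^n$ is called $h$-dense if each sub-cube of $Q^n_s$ with side $h$ (closed, faces parallel to the coordinate hyperplanes) contains a point of $Z$.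
   Formalization: The formal theorem adds the hypothesis s ≤ 1 (implied when the cube lies in the unit ball); without it the claim is false: for large s take h = s, Z = {0} and f(x) = x_1, giving rigidity 0. *)

theory Defs
  imports "HOL-Analysis.Analysis"
begin

text \<open>Derivatives on the closed ball are taken within the ball (in the Frechet sense), so that they
  are also meaningful, and unique, at boundary points. Functions are total on the whole space,
  but only their values on the ball matter.\<close>

definition partial_deriv ::
    "(real ^ 'n) set \<Rightarrow> 'n \<Rightarrow> (real ^ 'n \<Rightarrow> real) \<Rightarrow> real ^ 'n \<Rightarrow> real" where
  "partial_deriv S i f x = frechet_derivative f (at x within S) (axis i 1)"

text \<open>An iterated partial derivative of order \<open>l\<close> is indexed by the list (of length \<open>l\<close>) of the
  coordinates with respect to which one differentiates.\<close>

definition iter_partial_deriv ::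
    "(real ^ 'n) set \<Rightarrow> 'n list \<Rightarrow> (real ^ 'n \<Rightarrow> real) \<Rightarrow> real ^ 'n \<Rightarrow> real" where
  "iter_partial_deriv S is f = foldr (partial_deriv S) is f"

primrec C_smooth_on :: "nat \<Rightarrow> (real ^ 'n) set \<Rightarrow> (real ^ 'n \<Rightarrow> real) \<Rightarrow> bool" where
  "C_smooth_on 0 S f \<longleftrightarrow> continuous_on S f"
| "C_smooth_on (Suc k) S f \<longleftrightarrow>
     f differentiable_on S \<and> (\<forall>i. C_smooth_on k S (partial_deriv S i f))"

definition deriv_norm :: "nat \<Rightarrow> (real ^ 'n \<Rightarrow> real) \<Rightarrow> real ^ 'n \<Rightarrow> real" where
  "deriv_norm l f z =
     Max ((\<lambda>is. \<bar>iter_partial_deriv (cball 0 1) is f z\<bar>) ` {is. length is = l})"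

text \<open>The supremum is a maximum when \<open>f\<close> is \<open>C\<^sup>l\<close>, since the ball is compact.\<close>

definition M_norm :: "nat \<Rightarrow> (real ^ 'n \<Rightarrow> real) \<Rightarrow> real" where
  "M_norm l f = (SUP z\<in>cball 0 1. deriv_norm l f z)"

definition U_class :: "nat \<Rightarrow> (real ^ 'n) set \<Rightarrow> (real ^ 'n \<Rightarrow> real) set" where
  "U_class d Z = {f. C_smooth_on (d + 1) (cball 0 1) f \<and> (\<forall>z\<in>Z. f z = 0) \<and> M_norm 0 f = 1}"

text \<open>For \<open>Z\<close> inside the ball of radius \<open>1/3\<close> the class is nonempty (a normalised bump function
  supported near a point outside that ball belongs to it), so this is a genuine real infimum.\<close>

definition rigidity :: "nat \<Rightarrow> (real ^ 'n) set \<Rightarrow> real" where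
  "rigidity d Z = (INF f\<in>U_class d Z. M_norm (d + 1) f)"

definition cube :: "real \<Rightarrow> (real ^ 'n) set" where
  "cube s = cbox 0 (vec s)"

definition h_dense :: "real \<Rightarrow> real \<Rightarrow> (real ^ 'n) set \<Rightarrow> bool" where
  "h_dense h s Z \<longleftrightarrow> finite Z \<and> Z \<subseteq> cube s \<and>
     (\<forall>a. cbox a (a + vec h) \<subseteq> cube s \<longrightarrow> cbox a (a + vec h) \<inter> Z \<noteq> {})"

end

theory Submission
  imports Defs
begin

text \<open>Let \<open>A\<^sub>k\<close> be the maximum over the cube of the partial derivatives of order \<open>k\<close>. Landau's
  inequality in coordinate directions, \<open>A\<^sub>k\<^sub>+\<^sub>1 \<le> 2 A\<^sub>k / \<delta> + \<delta> A\<^sub>k\<^sub>+\<^sub>2\<close> for \<open>0 < \<delta> \<le> s / 2\<close>, gives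
  \<open>s\<^sup>k A\<^sub>k \<le> K A\<^sub>0 + s\<^sup>m A\<^sub>m\<close> for \<open>1 \<le> k \<le> m = d + 1\<close>. Since the zeros of \<open>f\<close> are \<open>h\<close>-dense,
  \<open>A\<^sub>0 \<le> n h A\<^sub>1\<close>; so if \<open>h / s\<close> is small then \<open>A\<^sub>0\<close> is absorbed and every \<open>A\<^sub>k\<close> with \<open>k \<le> m\<close> is at most
  a constant times \<open>A\<^sub>m\<close>. In particular all derivatives of \<open>f\<close> at the centre of the ball are
  controlled by \<open>M\<^sub>m(f)\<close>, and integrating outwards bounds \<open>M\<^sub>0(f) = 1\<close> by a constant times \<open>M\<^sub>m(f)\<close>.\<close>

subsection \<open>Landau-type recursive inequalities\<close>

text \<open>Induction on \<open>k\<close>: the recursive inequality one level up contains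
  \<open>a (Suc k)\<close>, which the induction hypothesis replaces by \<open>a 0\<close> and a
  multiple of \<open>a (Suc (Suc k))\<close> small enough to be absorbed on the left.
  \<open>K\<close> is fixed before \<open>a\<close>, so it depends only on \<open>k\<close> and
  \<open>\<eta>\<close>.\<close>

lemma landau_chain:
  fixes \<eta> :: real
  assumes "0 < \<eta>" "\<eta> \<le> 1/2"
  shows "\<exists>K\<ge>0. \<forall>a :: nat \<Rightarrow> real.
    (\<forall>j\<le>k. \<forall>\<eta>. 0 < \<eta> \<longrightarrow> \<eta> \<le> 1/2 \<longrightarrow> a (Suc j) \<le> 2 * a j / \<eta> + \<eta> * a (Suc (Suc j))) \<longrightarrow>
    a (Suc k) \<le> K * a 0 + \<eta> * a (Suc (Suc k))"
  using assms
proof (induction k arbitrary: \<eta>)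
  case 0
  show ?case by (rule exI[of _ "2 / \<eta>"]) (use 0 in auto)
next
  case (Suc k)
  \<comment> \<open>With \<open>\<eta>/8\<close> here and \<open>\<eta>/2\<close> in the new
    inequality, the absorbed coefficient is \<open>2 * (\<eta>/8) / (\<eta>/2) = 1/2\<close>;
    doubling then turns \<open>\<eta>/2\<close> into the required \<open>\<eta>\<close>.\<close>
  from Suc.IH[of "\<eta>/8"] Suc.prems obtain K where K: "K \<ge> 0"
    "\<And>a :: nat \<Rightarrow> real. \<forall>j\<le>k. \<forall>\<eta>. 0 < \<eta> \<longrightarrow> \<eta> \<le> 1/2 \<longrightarrow> a (Suc j) \<le> 2 * a j / \<eta> + \<eta> * a (Suc (Suc j)) \<Longrightarrow>
       a (Suc k) \<le> K * a 0 + \<eta> / 8 * a (Suc (Suc k))" by auto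
  show ?case
  proof (intro exI[of _ "8 * K / \<eta>"] conjI allI impI)
    show "0 \<le> 8 * K / \<eta>" using K(1) Suc.prems by simp
    fix a :: "nat \<Rightarrow> real"
    assume h: "\<forall>j\<le>Suc k. \<forall>\<eta>. 0 < \<eta> \<longrightarrow> \<eta> \<le> 1/2 \<longrightarrow> a (Suc j) \<le> 2 * a j / \<eta> + \<eta> * a (Suc (Suc j))"
    have "a (Suc (Suc k)) \<le> 2 * a (Suc k) / (\<eta>/2) + \<eta>/2 * a (Suc (Suc (Suc k)))"
      by (rule h[rule_format]) (use Suc.prems in auto)
    moreover have "a (Suc k) \<le> K * a 0 + \<eta> / 8 * a (Suc (Suc k))"
      by (rule K(2)) (use h le_SucI in blast)
    then have "2 * a (Suc k) / (\<eta>/2) \<le> 2 * (K * a 0 + \<eta> / 8 * a (Suc (Suc k))) / (\<eta>/2)"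
      using Suc.prems by (intro divide_right_mono mult_left_mono) auto
    moreover have "2 * (K * a 0 + \<eta> / 8 * a (Suc (Suc k))) / (\<eta>/2) = 4 * K / \<eta> * a 0 + a (Suc (Suc k)) / 2"
      using Suc.prems by (simp add: field_simps)
    moreover have "8 * K / \<eta> * a 0 = 2 * (4 * K / \<eta> * a 0)" by simp
    ultimately show "a (Suc (Suc k)) \<le> 8 * K / \<eta> * a 0 + \<eta> * a (Suc (Suc (Suc k)))"
      by linarith
  qed
qed

text \<open>Induction on the top order: intermediate terms are bounded through \<open>a m\<close>,
  and \<open>landau_chain\<close> trades \<open>a m\<close> for \<open>a (Suc m)\<close>.\<close>

lemma landau_interpolation:
  "\<exists>K\<ge>0. \<forall>a :: nat \<Rightarrow> real.
    (\<forall>j\<le>m. 0 \<le> a j) \<longrightarrow>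
    (\<forall>j. j + 2 \<le> m \<longrightarrow>
       (\<forall>\<eta>. 0 < \<eta> \<longrightarrow> \<eta> \<le> 1/2 \<longrightarrow> a (Suc j) \<le> 2 * a j / \<eta> + \<eta> * a (Suc (Suc j)))) \<longrightarrow>
    (\<forall>k. 1 \<le> k \<longrightarrow> k \<le> m \<longrightarrow> a k \<le> K * a 0 + a m)"
proof (induction m)
  case 0
  show ?case by (rule exI[of _ 0]) auto
next
  case (Suc m)
  let ?L = "\<lambda>(a :: nat \<Rightarrow> real) j. \<forall>\<eta>. 0 < \<eta> \<longrightarrow> \<eta> \<le> 1/2 \<longrightarrow> a (Suc j) \<le> 2 * a j / \<eta> + \<eta> * a (Suc (Suc j))"
  from Suc.IH obtain K where K: "0 \<le> K" "\<forall>a. (\<forall>j\<le>m. 0 \<le> a j) \<longrightarrow> (\<forall>j. j + 2 \<le> m \<longrightarrow> ?L a j) \<longrightarrow>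
      (\<forall>k. 1 \<le> k \<longrightarrow> k \<le> m \<longrightarrow> a k \<le> K * a 0 + a m)"
    by (elim exE conjE) (rule that)
  \<comment> \<open>The index \<open>m - 1\<close> turns \<open>Suc k\<close> into \<open>m\<close>.
    This is used only for \<open>m \<ge> 1\<close>: when \<open>m = 0\<close>, the only admissible
    \<open>k\<close> is \<open>Suc m\<close>.\<close>
  from landau_chain[of "1/2" "m - 1"]
  obtain K' where K': "0 \<le> K'" "\<forall>a. (\<forall>j\<le>m - 1. ?L a j) \<longrightarrow>
      a (Suc (m - 1)) \<le> K' * a 0 + 1/2 * a (Suc (Suc (m - 1)))"
    by (elim meta_impE exE conjE) (simp, simp, rule that)
  show ?case
  proof (intro exI[of _ "K + K'"] conjI allI impI)
    show "0 \<le> K + K'" using K K' by simp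
    fix a :: "nat \<Rightarrow> real" and k
    assume nn: "\<forall>j\<le>Suc m. 0 \<le> a j"
      and h: "\<forall>j. j + 2 \<le> Suc m \<longrightarrow>
       (\<forall>\<eta>. 0 < \<eta> \<longrightarrow> \<eta> \<le> 1/2 \<longrightarrow> a (Suc j) \<le> 2 * a j / \<eta> + \<eta> * a (Suc (Suc j)))"
      and k: "1 \<le> k" "k \<le> Suc m"
    have a0: "0 \<le> K * a 0" "0 \<le> K' * a 0" using nn K(1) K'(1) by auto
    show "a k \<le> (K + K') * a 0 + a (Suc m)"
    proof (cases "k = Suc m")
      case True
      then show ?thesis using a0 by (simp add: distrib_right)
    next
      case False
      then have k': "k \<le> m" "m \<ge> 1" using k by auto
      have "a k \<le> K * a 0 + a m"
        by (rule K(2)[THEN spec, THEN mp, THEN mp, THEN spec, THEN mp, THEN mp])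
          (use nn h k' k(1) in auto)
      moreover have "a (Suc (m - 1)) \<le> K' * a 0 + 1/2 * a (Suc (Suc (m - 1)))"
        by (rule K'(2)[THEN spec, THEN mp]) (use h k'(2) in auto)
      then have "a m \<le> K' * a 0 + 1/2 * a (Suc m)" using k'(2) by simp
      moreover have "0 \<le> a (Suc m)" using nn by simp
      ultimately show ?thesis by (simp add: distrib_right)
    qed
  qed
qed

subsection \<open>Mean value estimates for partial derivatives\<close>

text \<open>The one-variable mean value theorem applies to \<open>g\<close> along the segment. A
  derivative within \<open>S\<close> restricts to the segment, so boundary points of
  \<open>S\<close> are allowed.\<close>

lemma partial_deriv_mvt:
  fixes g :: "real ^ 'n \<Rightarrow> real"
  assumes g: "g differentiable_on S" and seg: "closed_segment x y \<subseteq> S"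
  obtains t where "t \<in> closed_segment x y"
    and "g y - g x = (\<Sum>i\<in>UNIV. (y - x) $ i * partial_deriv S i g t)"
proof -
  define p where "p u = x + u *\<^sub>R (y - x)" for u :: real
  have p_in: "p u \<in> closed_segment x y" if "u \<in> {0..1}" for u
    using that by (auto simp: p_def in_segment algebra_simps intro!: exI[of _ u])
  let ?D = "\<lambda>z. frechet_derivative g (at z within S)"
  have D: "(g has_derivative ?D z) (at z within S)" if "z \<in> S" for z
    using g that by (simp add: differentiable_on_def frechet_derivative_works)
  have "((g \<circ> p) has_derivative (?D (p u) \<circ> (\<lambda>h. h *\<^sub>R (y - x)))) (at u within {0..1})"
    if "0 \<le> u" "u \<le> 1" for u
  proof (rule diff_chain_within)
    show "(p has_derivative (\<lambda>h. h *\<^sub>R (y - x))) (at u within {0..1})"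
      unfolding p_def by (auto intro!: derivative_eq_intros)
    show "(g has_derivative ?D (p u)) (at (p u) within p ` {0..1})"
    proof (rule has_derivative_subset[OF D])
      show "p u \<in> S" using p_in[of u] seg that by auto
      show "p ` {0..1} \<subseteq> S" using p_in seg by blast
    qed
  qed
  from mvt_very_simple[of 0 1 "g \<circ> p", OF _ this]
  obtain u where u: "u \<in> {0..1}" "(g \<circ> p) 1 - (g \<circ> p) 0 = ?D (p u) (y - x)"
    by auto
  have lin: "linear (?D (p u))"
    using D[of "p u"] p_in[OF u(1)] seg has_derivative_linear by blast
  have "?D (p u) (y - x) = ?D (p u) (\<Sum>i\<in>UNIV. (y - x) $ i *\<^sub>R axis i 1)"
    by (metis (no_types) basis_expansion scalar_mult_eq_scaleR)
  also have "\<dots> = (\<Sum>i\<in>UNIV. (y - x) $ i * partial_deriv S i g (p u))"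
    by (simp add: linear_sum[OF lin] linear_scale[OF lin] partial_deriv_def)
  finally have "g y - g x = (\<Sum>i\<in>UNIV. (y - x) $ i * partial_deriv S i g (p u))"
    using u(2) by (simp add: p_def)
  with p_in[OF u(1)] that show ?thesis by blast
qed

lemma partial_deriv_diff_bound:
  fixes g :: "real ^ 'n \<Rightarrow> real" and r B :: real
  assumes g: "g differentiable_on S" and seg: "closed_segment x y \<subseteq> S"
    and xy: "\<And>i. \<bar>(y - x) $ i\<bar> \<le> r"
    and B: "\<And>i t. t \<in> closed_segment x y \<Longrightarrow> \<bar>partial_deriv S i g t\<bar> \<le> B"
  shows "\<bar>g y - g x\<bar> \<le> CARD('n) * r * B"
proof -
  obtain t where t: "t \<in> closed_segment x y"
    "g y - g x = (\<Sum>i\<in>UNIV. (y - x) $ i * partial_deriv S i g t)"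
    using partial_deriv_mvt[OF g seg] by blast
  have r: "0 \<le> r" using xy[of undefined] by linarith
  have "\<bar>g y - g x\<bar> \<le> (\<Sum>i\<in>UNIV. \<bar>(y - x) $ i * partial_deriv S i g t\<bar>)"
    unfolding t(2) by (rule sum_abs)
  also have "\<dots> \<le> (\<Sum>i\<in>(UNIV :: 'n set). r * B)"
    by (intro sum_mono) (use xy B[OF t(1)] r in \<open>simp add: abs_mult mult_mono\<close>)
  finally show ?thesis by simp
qed

text \<open>A step of length \<open>\<delta>\<close> along axis \<open>i\<close> changes
  \<open>g\<close> by at most \<open>2 * A0\<close>, so the partial derivative is at most
  \<open>2 * A0 / \<delta>\<close> at some point of the step. Returning from that point to
  \<open>x\<close> costs at most \<open>\<delta> * A2\<close>.\<close>

lemma partial_deriv_landau: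
  fixes g :: "real ^ 'n \<Rightarrow> real"
  assumes g: "g differentiable_on S" "partial_deriv S i g differentiable_on S"
    and Q: "cube s \<subseteq> S" and x: "x \<in> cube s" and dl: "0 < \<delta>" "\<delta> \<le> s / 2"
    and A0: "\<And>y. y \<in> cube s \<Longrightarrow> \<bar>g y\<bar> \<le> A0"
    and A2: "\<And>y. y \<in> cube s \<Longrightarrow> \<bar>partial_deriv S i (partial_deriv S i g) y\<bar> \<le> A2"
  shows "\<bar>partial_deriv S i g x\<bar> \<le> 2 * A0 / \<delta> + \<delta> * A2"
proof -
  \<comment> \<open>The step goes towards the farther face; as \<open>\<delta> \<le> s / 2\<close>,
    it stays in the cube.\<close>
  define c where "c = (if x $ i \<le> s / 2 then \<delta> else - \<delta>)"
  define y where "y = x + c *\<^sub>R axis i 1"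
  have c: "\<bar>c\<bar> = \<delta>" using dl by (simp add: c_def)
  have y: "y \<in> cube s"
    using x dl by (auto simp: y_def c_def cube_def mem_box_cart axis_def) (smt (verit))
  have sub: "closed_segment a b \<subseteq> cube s" if "a \<in> cube s" "b \<in> cube s" for a b :: "real ^ 'n"
    using that unfolding cube_def by (intro closed_segment_subset convex_box) auto
  have axis_sum: "(\<Sum>j\<in>UNIV. (k *\<^sub>R axis i 1 :: real ^ 'n) $ j * F j) = k * F i" for k F
    by (simp add: axis_def if_distrib if_distribR cong: if_cong)
  obtain t where t: "t \<in> closed_segment x y"
    "g y - g x = (\<Sum>j\<in>UNIV. (y - x) $ j * partial_deriv S j g t)"
    using partial_deriv_mvt[OF g(1), of x y] sub[OF x y] Q by blast
  have eq1: "g y - g x = c * partial_deriv S i g t"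
    using t(2) axis_sum[of c] by (simp add: y_def)
  have tQ: "t \<in> cube s" using t(1) sub[OF x y] by blast
  obtain u where u: "0 \<le> u" "u \<le> 1" "t = x + (u * c) *\<^sub>R axis i 1"
    using t(1) by (auto simp: in_segment y_def algebra_simps)
  obtain t' where t': "t' \<in> closed_segment x t"
    "partial_deriv S i g t - partial_deriv S i g x
      = (\<Sum>j\<in>UNIV. (t - x) $ j * partial_deriv S j (partial_deriv S i g) t')"
    using partial_deriv_mvt[OF g(2), of x t] sub[OF x tQ] Q by blast
  have eq2: "partial_deriv S i g t - partial_deriv S i g x
      = (u * c) * partial_deriv S i (partial_deriv S i g) t'"
    using t'(2) axis_sum[of "u * c"] by (simp add: u(3))
  have t'Q: "t' \<in> cube s" using t'(1) sub[OF x tQ] by blast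
  have "\<bar>partial_deriv S i g t - partial_deriv S i g x\<bar> \<le> \<delta> * A2"
    unfolding eq2 abs_mult c using u dl A2[OF t'Q]
    by (intro mult_mono) (auto simp: mult_left_le_one_le)
  moreover have "\<delta> * \<bar>partial_deriv S i g t\<bar> \<le> 2 * A0"
    using arg_cong[OF eq1, of abs] A0[OF x] A0[OF y] by (simp add: abs_mult c)
  then have "\<bar>partial_deriv S i g t\<bar> \<le> 2 * A0 / \<delta>"
    using dl by (simp add: field_simps)
  ultimately show ?thesis by linarith
qed

subsection \<open>Iterated partial derivatives\<close>

lemma iter_partial_deriv_Cons [simp]:
  "iter_partial_deriv S (i # is) f = partial_deriv S i (iter_partial_deriv S is f)"
  and iter_partial_deriv_Nil [simp]: "iter_partial_deriv S [] f = f"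
  by (simp_all add: iter_partial_deriv_def)

text \<open>\<open>foldr\<close> applies the last entry of the list first, and
  \<open>C_smooth_on\<close> peels off the innermost derivative, hence the induction from the
  right.\<close>

lemma C_smooth_on_iter_partial_deriv:
  assumes "C_smooth_on (length is + k) S f"
  shows "C_smooth_on k S (iter_partial_deriv S is f)"
  using assms
  by (induction "is" arbitrary: f rule: rev_induct) (simp_all add: iter_partial_deriv_def)

lemma C_smooth_on_imp_continuous_on: "C_smooth_on k S f \<Longrightarrow> continuous_on S f"
  by (cases k) (auto intro: differentiable_imp_continuous_on)

lemma C_smooth_on_mono: "C_smooth_on k S f \<Longrightarrow> j \<le> k \<Longrightarrow> C_smooth_on j S f"
proof (induction k arbitrary: f j)
  case (Suc k)
  then show ?case by (cases j) (auto intro: differentiable_imp_continuous_on)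
qed simp

lemma iter_partial_deriv_le_deriv_norm:
  "\<bar>iter_partial_deriv (cball 0 1) is f z\<bar> \<le> deriv_norm (length is) f z"
  unfolding deriv_norm_def
  by (intro Max_ge finite_imageI imageI)
    (use finite_lists_length_eq[OF finite, of UNIV "length is"] in simp_all)

lemma deriv_norm_le:
  fixes f :: "real ^ 'n \<Rightarrow> real"
  assumes "\<And>is. length is = l \<Longrightarrow> \<bar>iter_partial_deriv (cball 0 1) is f z\<bar> \<le> B"
  shows "deriv_norm l f z \<le> B"
proof -
  have "{is :: 'n list. length is = l} \<noteq> {}" using Ex_list_of_length by auto
  then show ?thesis
    unfolding deriv_norm_def using finite_lists_length_eq[of "UNIV :: 'n set" l] assms
    by (subst Max_le_iff) auto
qed

lemma deriv_norm_nonneg: "0 \<le> deriv_norm l f z"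
  using iter_partial_deriv_le_deriv_norm[of "replicate l undefined" f z] by simp

text \<open>A real supremum bounds its family only if the family is bounded. Here each of the
  finitely many derivatives is continuous on the compact ball.\<close>

lemma bdd_above_deriv_norm:
  fixes f :: "real ^ 'n \<Rightarrow> real"
  assumes f: "C_smooth_on m (cball 0 1) f" and "l \<le> m" and Q: "Q \<subseteq> cball 0 1"
  shows "bdd_above (deriv_norm l f ` Q)"
proof -
  have "\<exists>B. \<forall>z\<in>cball 0 1. \<bar>iter_partial_deriv (cball 0 1) is f z\<bar> \<le> B"
    if "length is = l" for "is" :: "'n list"
  proof -
    have "continuous_on (cball 0 1) (iter_partial_deriv (cball 0 1) is f)"
      by (rule C_smooth_on_imp_continuous_on[of "m - l"], rule C_smooth_on_iter_partial_deriv)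
        (use that f \<open>l \<le> m\<close> in simp)
    then have "bounded (iter_partial_deriv (cball 0 1) is f ` cball 0 1)"
      by (intro compact_imp_bounded compact_continuous_image) auto
    then show ?thesis by (auto simp: bounded_iff)
  qed
  then obtain B where B: "\<And>is z. length is = l \<Longrightarrow> z \<in> cball 0 1 \<Longrightarrow>
      \<bar>iter_partial_deriv (cball 0 1) is f z\<bar> \<le> B is"
    by metis
  have fin: "finite {is :: 'n list. length is = l}"
    using finite_lists_length_eq[of "UNIV :: 'n set" l] by simp
  show ?thesis
  proof (rule bdd_aboveI2)
    fix z assume "z \<in> Q"
    then have z: "z \<in> cball 0 1" using Q by blast
    show "deriv_norm l f z \<le> Max (B ` {is. length is = l})"
    proof (rule deriv_norm_le)
      fix "is" :: "'n list" assume l: "length is = l"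
      have "B is \<le> Max (B ` {is. length is = l})" using fin l by (intro Max_ge) auto
      then show "\<bar>iter_partial_deriv (cball 0 1) is f z\<bar> \<le> Max (B ` {is. length is = l})"
        using B[OF l z] by linarith
    qed
  qed
qed

lemma deriv_norm_0 [simp]: "deriv_norm 0 f z = \<bar>f z\<bar>"
  by (simp add: deriv_norm_def)

subsection \<open>Smooth functions on the ball with prescribed zeros\<close>

text \<open>The ball is not a box, and at its boundary points coordinate directions may be tangential;
  the directions towards interior points determine the derivative.\<close>

lemma has_derivative_unique_within_convex:
  fixes f :: "'a :: real_normed_vector \<Rightarrow> real"
  assumes S: "convex S" "cball c r \<subseteq> S" "0 < r" and x: "x \<in> S"
    and D: "(f has_derivative D) (at x within S)" "(f has_derivative D') (at x within S)"
  shows "D = D'"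
proof -
  define L where "L v = D v - D' v" for v
  have L: "((\<lambda>x. 0) has_derivative L) (at x within S)"
    using has_derivative_diff[OF D] by (simp add: L_def[abs_def])
  then interpret L: bounded_linear L by (rule has_derivative_bounded_linear)
  \<comment> \<open>Along the segment from \<open>x\<close> to \<open>y\<close> the zero function
    has derivative \<open>L (y - x)\<close>, and one-variable derivatives on a closed interval are
    unique.\<close>
  have L0: "L (y - x) = 0" if "y \<in> S" for y
  proof -
    define p where "p u = x + u *\<^sub>R (y - x)" for u :: real
    have "(((\<lambda>x. 0) \<circ> p) has_derivative (L \<circ> (\<lambda>h. h *\<^sub>R (y - x)))) (at 0 within {0..1})"
    proof (rule diff_chain_within)
      show "(p has_derivative (\<lambda>h. h *\<^sub>R (y - x))) (at 0 within {0..1})"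
        unfolding p_def by (auto intro!: derivative_eq_intros)
      have "p ` {0..1} \<subseteq> S"
        using convexD_alt[OF S(1) x that] by (auto simp: p_def algebra_simps)
      then show "((\<lambda>x. 0) has_derivative L) (at (p 0) within p ` {0..1})"
        using has_derivative_subset[OF L] by (simp add: p_def)
    qed
    then have "((\<lambda>_. 0 :: real) has_vector_derivative L (y - x)) (at 0 within cbox 0 1)"
      by (simp add: has_vector_derivative_def L.scaleR o_def)
    then show ?thesis
      using vector_derivative_unique_within_closed_interval[of 0 1 0 "\<lambda>_. 0 :: real" "L (y - x)" 0]
      by simp
  qed
  have "L v = 0" for v
  proof (cases "v = 0")
    case False
    define k where "k = r / norm v"
    have k: "k > 0" using False S(3) by (simp add: k_def)
    \<comment> \<open>Two points of \<open>S\<close> that differ by a positive multiple of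
      \<open>v\<close>: subtracting the two instances of \<open>L0\<close> eliminates
      \<open>x\<close>.\<close>
    have "c \<in> S" "c + k *\<^sub>R v \<in> S"
      using S False by (auto simp: k_def dist_norm subset_iff)
    from L0[OF this(1)] L0[OF this(2)] have "L ((c + k *\<^sub>R v - x) - (c - x)) = 0"
      by (simp only: L.diff)
    then show ?thesis using k by (simp add: L.scaleR)
  qed (simp add: L.zero)
  then show ?thesis by (auto simp: L_def)
qed

section \<open>Calculus of smooth functions on the ball\<close>

text \<open>\<open>frechet_derivative\<close> is a choice among derivatives; uniqueness on the ball
  identifies it with any derivative found by the usual rules.\<close>

lemma partial_deriv_eqI:
  assumes "(f has_derivative D) (at x within cball 0 1)" "x \<in> cball 0 1"
  shows "partial_deriv (cball 0 1) i f x = D (axis i 1)"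
proof -
  have "(f has_derivative frechet_derivative f (at x within cball 0 1)) (at x within cball 0 1)"
    using assms(1) differentiableI frechet_derivative_works by blast
  from has_derivative_unique_within_convex[OF convex_cball subset_refl zero_less_one assms(2) this assms(1)]
  show ?thesis by (simp add: partial_deriv_def)
qed

text \<open>Differentiation rules give identities between partial derivatives only at points of
  \<open>S\<close>; this lemma carries smoothness across them. Functions equal on \<open>S\<close>
  have the same derivatives within \<open>S\<close>, so the choice in
  \<open>frechet_derivative\<close> agrees even without uniqueness.\<close>

lemma C_smooth_on_cong:
  assumes "C_smooth_on k S f" "\<And>x. x \<in> S \<Longrightarrow> f x = g x"
  shows "C_smooth_on k S g"
  using assms
proof (induction k arbitrary: f g)
  case 0
  then show ?case by (simp cong: continuous_on_cong)
next
  case (Suc k)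
  have D: "(f has_derivative D) (at x within S) \<longleftrightarrow> (g has_derivative D) (at x within S)"
    if "x \<in> S" for x D
    using Suc.prems(2) that has_derivative_transform[OF that, of f g D]
      has_derivative_transform[OF that, of g f D] by auto
  have "g differentiable_on S"
    using Suc.prems(1) D by (auto simp: differentiable_on_def differentiable_def)
  moreover have "partial_deriv S i f x = partial_deriv S i g x" if "x \<in> S" for i x
    using D[OF that] by (simp add: partial_deriv_def frechet_derivative_def)
  then have "C_smooth_on k S (partial_deriv S i g)" for i
    using Suc.IH Suc.prems(1) by (metis C_smooth_on.simps(2))
  ultimately show ?case by simp
qed

lemma C_smooth_on_const: "C_smooth_on k (cball 0 1 :: (real ^ 'n) set) (\<lambda>_. c)"
proof (induction k arbitrary: c)
  case (Suc k)
  have "C_smooth_on k (cball 0 1) (partial_deriv (cball 0 1) i (\<lambda>_. c))" for i :: 'n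
    by (rule C_smooth_on_cong[OF Suc[of 0]]) (subst partial_deriv_eqI[OF has_derivative_const], auto)
  then show ?case by simp
qed simp

lemma C_smooth_on_add:
  assumes "C_smooth_on k (cball 0 1) f" "C_smooth_on k (cball 0 1) g"
  shows "C_smooth_on k (cball 0 1) (\<lambda>x. f x + g x)"
  using assms
proof (induction k arbitrary: f g)
  case 0
  then show ?case by (simp add: continuous_on_add)
next
  case (Suc k)
  let ?B = "cball 0 1 :: (real ^ 'a) set"
  have "partial_deriv ?B i f x + partial_deriv ?B i g x = partial_deriv ?B i (\<lambda>x. f x + g x) x"
    if "x \<in> ?B" for i x
  proof -
    have "(f has_derivative frechet_derivative f (at x within ?B)) (at x within ?B)"
      "(g has_derivative frechet_derivative g (at x within ?B)) (at x within ?B)"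
      using Suc.prems that by (simp_all add: differentiable_on_def frechet_derivative_works)
    from partial_deriv_eqI[OF has_derivative_add[OF this] that]
    show ?thesis by (simp add: partial_deriv_def)
  qed
  then have "C_smooth_on k ?B (partial_deriv ?B i (\<lambda>x. f x + g x))" for i
    using C_smooth_on_cong[OF Suc.IH[of "partial_deriv ?B i f" "partial_deriv ?B i g"]] Suc.prems
    by simp
  then show ?case using Suc.prems by (simp add: differentiable_on_add)
qed

lemma C_smooth_on_mult:
  assumes "C_smooth_on k (cball 0 1) f" "C_smooth_on k (cball 0 1) g"
  shows "C_smooth_on k (cball 0 1) (\<lambda>x. f x * g x)"
  using assms
proof (induction k arbitrary: f g)
  case 0
  then show ?case by (simp add: continuous_on_mult)
next
  case (Suc k)
  let ?B = "cball 0 1 :: (real ^ 'a) set"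
  have "f x * partial_deriv ?B i g x + partial_deriv ?B i f x * g x
      = partial_deriv ?B i (\<lambda>x. f x * g x) x"
    if "x \<in> ?B" for i x
  proof -
    have "(f has_derivative frechet_derivative f (at x within ?B)) (at x within ?B)"
      "(g has_derivative frechet_derivative g (at x within ?B)) (at x within ?B)"
      using Suc.prems that by (simp_all add: differentiable_on_def frechet_derivative_works)
    from partial_deriv_eqI[OF has_derivative_mult[OF this] that]
    show ?thesis by (simp add: partial_deriv_def)
  qed
  \<comment> \<open>The product rule also contains \<open>f\<close> and \<open>g\<close>
    undifferentiated, so the induction hypothesis needs them at the lower order
    \<open>k\<close>.\<close>
  moreover have "C_smooth_on k ?B f" "C_smooth_on k ?B g"
    using Suc.prems by (auto intro: C_smooth_on_mono[of "Suc k"])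
  then have "C_smooth_on k ?B (\<lambda>x. f x * partial_deriv ?B i g x + partial_deriv ?B i f x * g x)" for i
    using Suc.prems by (intro C_smooth_on_add Suc.IH) auto
  ultimately have "C_smooth_on k ?B (partial_deriv ?B i (\<lambda>x. f x * g x))" for i
    using C_smooth_on_cong by blast
  then show ?case using Suc.prems by (simp add: differentiable_on_mult)
qed

lemma C_smooth_on_nth_diff: "C_smooth_on k (cball 0 1) (\<lambda>x. x $ i - c)"
proof (cases k)
  case 0
  then show ?thesis by (auto intro!: continuous_intros)
next
  case (Suc k')
  have D: "((\<lambda>x. x $ i - c) has_derivative (\<lambda>h. h $ i)) (at x within cball 0 1)" for x
    by (auto intro!: derivative_eq_intros bounded_linear_imp_has_derivative bounded_linear_vec_nth)
  then have "C_smooth_on k' (cball 0 1) (partial_deriv (cball 0 1) j (\<lambda>x. x $ i - c))" for j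
    by (intro C_smooth_on_cong[OF C_smooth_on_const[of k' "axis j 1 $ i"]])
      (subst partial_deriv_eqI[OF D], auto)
  moreover have "(\<lambda>x. x $ i - c) differentiable_on cball 0 1"
    using D by (auto simp: differentiable_on_def differentiable_def)
  ultimately show ?thesis using Suc by simp
qed

lemma C_smooth_on_prod:
  assumes "\<And>z. z \<in> Z \<Longrightarrow> C_smooth_on k (cball 0 1) (F z)"
  shows "C_smooth_on k (cball 0 1) (\<lambda>x. \<Prod>z\<in>Z. F z x)"
  using assms
  by (induction Z rule: infinite_finite_induct) (simp_all add: C_smooth_on_const C_smooth_on_mult)

text \<open>\<open>rigidity\<close> is a real infimum, so a lower bound requires the class to be nonempty: take the
  normalised product of the affine functions \<open>x $ i - z $ i\<close> over the finite set \<open>Z\<close>.\<close>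

lemma U_class_nonempty:
  fixes Z :: "(real ^ 'n) set"
  assumes "finite Z"
  shows "U_class d Z \<noteq> {}"
proof -
  define i :: 'n where "i = undefined"
  define f where "f x = (\<Prod>z\<in>Z. x $ i - z $ i)" for x :: "real ^ 'n"
  have f: "C_smooth_on k (cball 0 1) f" for k
    unfolding f_def by (intro C_smooth_on_prod C_smooth_on_nth_diff)
  \<comment> \<open>The product vanishes only where coordinate \<open>i\<close> takes one of
    finitely many values, so some point of the axis inside the ball avoids its zeros. The maximum of
    \<open>\<bar>f\<bar>\<close> is therefore positive and can be divided out.\<close>
  have "infinite ({0..1 :: real} - (\<lambda>z. z $ i) ` Z)"
    using assms by (intro Diff_infinite_finite) (auto simp: infinite_Icc_iff)
  then obtain u where u: "u \<in> {0..1}" "u \<notin> (\<lambda>z. z $ i) ` Z"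
    by (metis DiffE equals0I finite.emptyI)
  have u': "axis i u \<in> cball 0 1" "f (axis i u) \<noteq> 0"
    using u assms by (auto simp: f_def norm_eq_sqrt_inner inner_axis_axis)
  have "continuous_on (cball 0 1) (\<lambda>x. \<bar>f x\<bar>)"
    by (intro continuous_intros C_smooth_on_imp_continuous_on[OF f])
  then obtain y where y: "y \<in> cball 0 1" "\<And>x. x \<in> cball 0 1 \<Longrightarrow> \<bar>f x\<bar> \<le> \<bar>f y\<bar>"
    using continuous_attains_sup[of "cball (0 :: real ^ 'n) 1" "\<lambda>x. \<bar>f x\<bar>"] by auto
  have fy: "\<bar>f y\<bar> > 0" using y(2)[OF u'(1)] u'(2) by linarith
  define g where "g x = (1 / \<bar>f y\<bar>) * f x" for x
  have "C_smooth_on (d + 1) (cball 0 1) g"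
    unfolding g_def by (intro C_smooth_on_mult C_smooth_on_const f)
  moreover have "g z = 0" if "z \<in> Z" for z
    using that assms by (auto simp: g_def f_def)
  moreover have "M_norm 0 g = 1"
    unfolding M_norm_def
  proof (rule cSup_eq_maximum)
    show "1 \<in> deriv_norm 0 g ` cball 0 1"
      using y(1) fy by (intro image_eqI[of _ _ y]) (auto simp: g_def)
    show "v \<le> 1" if "v \<in> deriv_norm 0 g ` cball 0 1" for v
      using that y(2) fy by (auto simp: g_def abs_mult)
  qed
  ultimately show ?thesis by (auto simp: U_class_def)
qed

subsection \<open>Functions with dense zeros\<close>

text \<open>The sub-cube at the corner \<open>vec s\<close> contains a point \<open>z\<close> of
  \<open>Z\<close> with all coordinates at least \<open>s - h \<ge> s / 2\<close>. Hence
  \<open>2 *\<^sub>R z\<close>, of norm at most 2/3, dominates every point of the cube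
  componentwise.\<close>

lemma cube_subset_cball:
  fixes Z :: "(real ^ 'n) set"
  assumes Z: "h_dense h s Z" "Z \<subseteq> cball 0 (1/3)" and h: "0 < h" "h \<le> s / 2"
  shows "(cube s :: (real ^ 'n) set) \<subseteq> cball 0 1"
proof
  fix x :: "real ^ 'n" assume x: "x \<in> cube s"
  have "cbox (vec (s - h)) (vec (s - h) + vec h) \<subseteq> (cube s :: (real ^ 'n) set)"
  proof
    fix y assume "y \<in> cbox (vec (s - h)) (vec (s - h) + vec h :: real ^ 'n)"
    then have "s - h \<le> y $ i" "y $ i \<le> s" for i by (auto simp: mem_box_cart)
    then have "0 \<le> y $ i" "y $ i \<le> s" for i using h by (smt (verit) field_sum_of_halves)+
    then show "y \<in> cube s" by (simp add: cube_def mem_box_cart)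
  qed
  then obtain z where z: "z \<in> Z" "z \<in> cbox (vec (s - h)) (vec (s - h) + vec h)"
    using Z(1) unfolding h_dense_def by blast
  have "norm (x $ i) \<le> norm ((2 *\<^sub>R z) $ i)" for i
  proof -
    have "s - h \<le> z $ i" "0 \<le> x $ i" "x $ i \<le> s"
      using z(2) x by (auto simp: cube_def mem_box_cart)
    then show ?thesis using h by simp
  qed
  then have "norm x \<le> norm (2 *\<^sub>R z)" by (rule norm_le_componentwise_cart)
  moreover have "norm z \<le> 1/3" using z(1) Z(2) by auto
  ultimately show "x \<in> cball 0 1" by simp
qed

lemma h_dense_near:
  fixes Z :: "(real ^ 'n) set"
  assumes Z: "h_dense h s Z" and h: "0 < h" "h \<le> s" and x: "x \<in> cube s"
  obtains z where "z \<in> Z" "\<And>i. \<bar>(x - z) $ i\<bar> \<le> h"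
proof -
  \<comment> \<open>The lower corner of a sub-cube of side \<open>h\<close> containing
    \<open>x\<close>; the minimum pulls it back from the far faces.\<close>
  define a :: "real ^ 'n" where "a = (\<chi> i. min (x $ i) (s - h))"
  have x': "0 \<le> x $ i" "x $ i \<le> s" for i using x by (auto simp: cube_def mem_box_cart)
  have "cbox a (a + vec h) \<subseteq> cube s"
  proof
    fix y assume "y \<in> cbox a (a + vec h)"
    then have y: "a $ i \<le> y $ i" "y $ i \<le> a $ i + h" for i by (auto simp: mem_box_cart)
    have a: "0 \<le> a $ i" "a $ i + h \<le> s" for i using x'[of i] h by (auto simp: a_def)
    have "0 \<le> y $ i \<and> y $ i \<le> s" for i using y[of i] a[of i] by linarith
    then show "y \<in> cube s" by (auto simp: cube_def mem_box_cart)
  qed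
  then obtain z where z: "z \<in> Z" "z \<in> cbox a (a + vec h)"
    using Z unfolding h_dense_def by blast
  have "\<bar>(x - z) $ i\<bar> \<le> h" for i
  proof -
    have "a $ i \<le> z $ i" "z $ i \<le> a $ i + h" using z(2) by (auto simp: mem_box_cart)
    moreover have "a $ i \<le> x $ i" "x $ i \<le> a $ i + h" using x'[of i] h by (auto simp: a_def min_def)
    ultimately show ?thesis by simp
  qed
  with z(1) that show ?thesis by blast
qed

section \<open>Derivatives at the centre and on the whole ball\<close>

text \<open>The origin is both a vertex of the cube and the centre of the ball, so estimates on the
  cube control the derivatives at the centre. \<open>K\<close> is the interpolation constant, fixed
  before \<open>f\<close>, \<open>s\<close>, \<open>h\<close> and \<open>Z\<close>.\<close>

lemma deriv_norm_cube_bound: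
  "\<exists>K :: real. 0 \<le> K \<and> (\<forall>f :: real ^ 'n \<Rightarrow> real. \<forall>s h Z.
     C_smooth_on m (cball 0 1) f \<longrightarrow> 1 \<le> m \<longrightarrow> 0 < s \<longrightarrow> s \<le> 1 \<longrightarrow> 0 < h \<longrightarrow> h \<le> s \<longrightarrow>
     (cube s :: (real ^ 'n) set) \<subseteq> cball 0 1 \<longrightarrow>
     h_dense h s Z \<longrightarrow> (\<forall>z\<in>Z. f z = 0) \<longrightarrow> h * (2 * real CARD('n) * (K + 1)) \<le> s \<longrightarrow>
     (\<forall>k\<le>m. deriv_norm k f 0 \<le> (K + 1) * M_norm m f))"
proof -
  let ?L = "\<lambda>(a :: nat \<Rightarrow> real) j. \<forall>\<eta>. 0 < \<eta> \<longrightarrow> \<eta> \<le> 1/2 \<longrightarrow> a (Suc j) \<le> 2 * a j / \<eta> + \<eta> * a (Suc (Suc j))"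
  from landau_interpolation[of m]
  obtain K where K: "0 \<le> K" "\<forall>a. (\<forall>j\<le>m. 0 \<le> a j) \<longrightarrow> (\<forall>j. j + 2 \<le> m \<longrightarrow> ?L a j) \<longrightarrow>
      (\<forall>k. 1 \<le> k \<longrightarrow> k \<le> m \<longrightarrow> a k \<le> K * a 0 + a m)"
    by (elim exE conjE) (rule that)
  show ?thesis
  proof (intro exI[of _ K] conjI allI impI)
    show "0 \<le> K" by fact
    fix f :: "real ^ 'n \<Rightarrow> real" and s h :: real and Z k
    assume f: "C_smooth_on m (cball 0 1) f" and m: "1 \<le> m" and s: "0 < s" "s \<le> 1"
      and h: "0 < h" "h \<le> s" and Q: "(cube s :: (real ^ 'n) set) \<subseteq> cball 0 1"
      and Z: "h_dense h s Z" "\<forall>z\<in>Z. f z = 0" and hs: "h * (2 * real CARD('n) * (K + 1)) \<le> s"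
      and k: "k \<le> m"
    let ?Q = "cube s :: (real ^ 'n) set" and ?B = "cball 0 1 :: (real ^ 'n) set"
    define A where "A l = (SUP z\<in>?Q. deriv_norm l f z)" for l
    have zero: "0 \<in> ?Q" using s by (simp add: cube_def mem_box_cart)
    have A: "deriv_norm l f z \<le> A l" if "l \<le> m" "z \<in> ?Q" for l z
      unfolding A_def by (rule cSUP_upper[OF that(2) bdd_above_deriv_norm[OF f that(1) Q]])
    have A': "\<bar>iter_partial_deriv ?B is f z\<bar> \<le> A (length is)" if "length is \<le> m" "z \<in> ?Q" for "is" z
      using A[OF that] iter_partial_deriv_le_deriv_norm[of "is" f z] by linarith
    have A_nonneg: "0 \<le> A l" if "l \<le> m" for l
      using A[OF that zero] deriv_norm_nonneg[of l f 0] by linarith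
    have A_le_M: "A m \<le> M_norm m f"
      unfolding A_def M_norm_def
      by (rule cSUP_subset_mono) (use zero Q bdd_above_deriv_norm[OF f le_refl] in auto)
    have landau: "A (Suc j) \<le> 2 * A j / \<delta> + \<delta> * A (Suc (Suc j))"
      if "j + 2 \<le> m" "0 < \<delta>" "\<delta> \<le> s / 2" for j \<delta>
      unfolding A_def[of "Suc j"]
    proof (rule cSUP_least)
      show "?Q \<noteq> {}" using zero by blast
      fix x assume x: "x \<in> ?Q"
      show "deriv_norm (Suc j) f x \<le> 2 * A j / \<delta> + \<delta> * A (Suc (Suc j))"
      proof (rule deriv_norm_le)
        fix "is" :: "'n list" assume "length is = Suc j"
        then obtain i js where js: "is = i # js" "length js = j" by (metis length_Suc_conv)
        have "C_smooth_on (Suc (Suc 0)) ?B (iter_partial_deriv ?B js f)"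
          by (rule C_smooth_on_iter_partial_deriv, rule C_smooth_on_mono[OF f])
            (use js that in simp)
        then have "\<bar>partial_deriv ?B i (iter_partial_deriv ?B js f) x\<bar> \<le> 2 * A j / \<delta> + \<delta> * A (Suc (Suc j))"
          using A'[of js] A'[of "i # i # js"] js that
          by (intro partial_deriv_landau[OF _ _ Q x]) auto
        then show "\<bar>iter_partial_deriv ?B is f x\<bar> \<le> 2 * A j / \<delta> + \<delta> * A (Suc (Suc j))"
          by (simp add: js)
      qed
    qed
    have zeros: "A 0 \<le> CARD('n) * h * A 1"
      unfolding A_def[of 0]
    proof (rule cSUP_least)
      show "?Q \<noteq> {}" using zero by blast
      fix x assume x: "x \<in> ?Q"
      obtain z where z: "z \<in> Z" "\<And>i. \<bar>(x - z) $ i\<bar> \<le> h"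
        using h_dense_near[OF Z(1) h x] by blast
      have "z \<in> ?Q" using z(1) Z(1) by (auto simp: h_dense_def)
      then have seg: "closed_segment z x \<subseteq> ?Q"
        using x unfolding cube_def by (intro closed_segment_subset convex_box) auto
      have "f differentiable_on ?B"
        using C_smooth_on_mono[OF f, of "Suc 0"] m by simp
      then have "\<bar>f x - f z\<bar> \<le> CARD('n) * h * A 1"
        using seg Q z(2) A'[of "[_]"] m by (intro partial_deriv_diff_bound[where S = ?B]) auto
      then show "deriv_norm 0 f x \<le> CARD('n) * h * A 1" using z(1) Z(2) by simp
    qed
    \<comment> \<open>Rescaling with \<open>\<delta> = \<eta> * s\<close> removes \<open>s\<close>
      from the Landau inequality, as \<open>landau_interpolation\<close> requires.\<close>
    define a where "a l = s ^ l * A l" for l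
    have a_nonneg: "0 \<le> a l" if "l \<le> m" for l using A_nonneg[OF that] s by (simp add: a_def)
    have a_landau: "a (Suc j) \<le> 2 * a j / \<eta> + \<eta> * a (Suc (Suc j))"
      if "j + 2 \<le> m" "0 < \<eta>" "\<eta> \<le> 1/2" for j \<eta>
    proof -
      have "A (Suc j) \<le> 2 * A j / (\<eta> * s) + (\<eta> * s) * A (Suc (Suc j))"
        using that s by (intro landau) auto
      then have "s ^ Suc j * A (Suc j) \<le> s ^ Suc j * (2 * A j / (\<eta> * s) + (\<eta> * s) * A (Suc (Suc j)))"
        using s by (intro mult_left_mono) auto
      also have "\<dots> = 2 * a j / \<eta> + \<eta> * a (Suc (Suc j))"
        using s that by (simp add: a_def field_simps)
      finally show ?thesis by (simp add: a_def)
    qed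
    have interp: "a l \<le> K * a 0 + a m" if "1 \<le> l" "l \<le> m" for l
      by (rule K(2)[THEN spec, THEN mp, THEN mp, THEN spec, THEN mp, THEN mp])
        (use a_nonneg a_landau that in auto)
    \<comment> \<open>Absorption of \<open>a 0\<close>: density and smallness of \<open>h\<close>
      give \<open>2 * (K + 1) * a 0 \<le> a 1\<close>, while interpolation gives
      \<open>a 1 \<le> K * a 0 + a m\<close>.\<close>
    have "2 * (K + 1) * a 0 \<le> (h * (2 * real CARD('n) * (K + 1))) * A 1"
      using mult_left_mono[OF zeros, of "2 * (K + 1)"] K(1) by (simp add: a_def algebra_simps)
    also have "\<dots> \<le> s * A 1" using hs A_nonneg m by (intro mult_right_mono) auto
    also have "\<dots> \<le> K * a 0 + a m" using interp[of 1] m by (simp add: a_def)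
    finally have a0: "(K + 2) * a 0 \<le> a m" by (simp add: algebra_simps)
    have Ka0: "0 \<le> a 0" "0 \<le> K * a 0" using a_nonneg K(1) by auto
    have "a 0 \<le> a m" using a0 Ka0 by (simp add: algebra_simps)
    moreover from this have "K * a 0 \<le> K * a m" using K(1) by (intro mult_left_mono)
    moreover have "0 \<le> K * a m" using K(1) a_nonneg by simp
    ultimately have "a k \<le> (K + 1) * a m"
      using interp[of k] k by (cases "k = 0") (auto simp: algebra_simps)
    also have "\<dots> = s ^ k * ((K + 1) * (s ^ (m - k) * A m))"
      using power_add[of s k "m - k"] k by (simp add: a_def)
    finally have "s ^ k * A k \<le> s ^ k * ((K + 1) * (s ^ (m - k) * A m))"
      by (simp add: a_def)
    then have "A k \<le> (K + 1) * (s ^ (m - k) * A m)"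
      using s by simp
    \<comment> \<open>The remaining power of \<open>s\<close> is at most 1 because
      \<open>s \<le> 1\<close>, which makes the bound uniform in \<open>s\<close>.\<close>
    also have "\<dots> \<le> (K + 1) * A m"
      using s K(1) A_nonneg[of m] by (intro mult_left_mono mult_left_le_one_le power_le_one) auto
    also have "\<dots> \<le> (K + 1) * M_norm m f"
      using A_le_M K(1) by (intro mult_left_mono) auto
    finally show "deriv_norm k f 0 \<le> (K + 1) * M_norm m f"
      using A[OF k zero] by linarith
  qed
qed

text \<open>Descending induction on the order, \<open>j\<close> counting the steps below
  \<open>m\<close>. A derivative of the next lower order differs from its value at the centre by at
  most \<open>CARD('n)\<close> times the current bound, since all coordinates of \<open>x\<close>
  are at most 1 in absolute value; adding the value at the centre gives the factor
  \<open>CARD('n) + 1\<close>.\<close>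

lemma deriv_norm_ball_bound:
  fixes f :: "real ^ 'n \<Rightarrow> real"
  assumes f: "C_smooth_on m (cball 0 1) f" and C: "1 \<le> C"
    and zero: "\<And>k. k \<le> m \<Longrightarrow> deriv_norm k f 0 \<le> C * M_norm m f"
    and "j \<le> m" "x \<in> cball 0 1"
  shows "deriv_norm (m - j) f x \<le> C * (real CARD('n) + 1) ^ j * M_norm m f"
proof -
  have M: "deriv_norm m f x \<le> M_norm m f" if "x \<in> cball 0 1" for x
    unfolding M_norm_def by (intro cSUP_upper bdd_above_deriv_norm[OF f] that) auto
  have M0: "0 \<le> M_norm m f"
    using deriv_norm_nonneg[of m f 0] M[of 0] by simp
  let ?B = "cball 0 1 :: (real ^ 'n) set" and ?N = "real CARD('n)"
  have "deriv_norm (m - j) f x \<le> C * (?N + 1) ^ j * M_norm m f"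
    using assms(4,5)
  proof (induction j arbitrary: x)
    case 0
    have "M_norm m f \<le> C * M_norm m f" using C M0 by (simp add: mult_le_cancel_right1)
    then show ?case using M[OF 0(2)] by simp
  next
    case (Suc j)
    define W where "W = C * (?N + 1) ^ j * M_norm m f"
    have W: "C * M_norm m f \<le> W"
      unfolding W_def using C M0 by (intro mult_right_mono) (auto simp: mult_le_cancel_left1)
    have "deriv_norm (m - Suc j) f x \<le> ?N * 1 * W + W"
    proof (rule deriv_norm_le)
      fix "is" :: "'n list" assume l: "length is = m - Suc j"
      define g where "g = iter_partial_deriv ?B is f"
      have "length is + Suc 0 \<le> m" using l Suc.prems(1) by simp
      then have "C_smooth_on (Suc 0) ?B g"
        unfolding g_def by (intro C_smooth_on_iter_partial_deriv C_smooth_on_mono[OF f])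
      then have g: "g differentiable_on ?B" by simp
      have seg: "closed_segment 0 x \<subseteq> ?B"
        using Suc.prems(2) by (intro closed_segment_subset convex_cball) simp_all
      have "\<bar>partial_deriv ?B i g t\<bar> \<le> W" if "t \<in> closed_segment 0 x" for i t
      proof -
        have "length (i # is) = m - j" using l Suc.prems(1) by simp
        then have "\<bar>partial_deriv ?B i g t\<bar> \<le> deriv_norm (m - j) f t"
          using iter_partial_deriv_le_deriv_norm[of "i # is" f t]
          by (simp only: g_def iter_partial_deriv_Cons)
        also have "\<dots> \<le> W"
          unfolding W_def by (rule Suc.IH) (use Suc.prems(1) subsetD[OF seg that] in simp_all)
        finally show ?thesis .
      qed
      moreover have "\<bar>(x - 0) $ i\<bar> \<le> 1" for i
        using component_le_norm_cart[of x i] Suc.prems(2) by simp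
      ultimately have "\<bar>g x - g 0\<bar> \<le> ?N * 1 * W"
        by (intro partial_deriv_diff_bound[OF g seg])
      moreover have "\<bar>g 0\<bar> \<le> C * M_norm m f"
        using iter_partial_deriv_le_deriv_norm[of "is" f 0] zero[of "m - Suc j"] l
        by (simp add: g_def)
      ultimately show "\<bar>iter_partial_deriv ?B is f x\<bar> \<le> ?N * 1 * W + W"
        using W unfolding g_def by linarith
    qed
    also have "\<dots> = C * (?N + 1) ^ Suc j * M_norm m f"
      by (simp add: W_def algebra_simps)
    finally show ?case .
  qed
  then show ?thesis .
qed

theorem theorem1p2:
  fixes d :: nat
  assumes "d \<ge> 1"
  shows "\<exists>\<xi>>0. \<exists>M>0. \<forall>s h. \<forall>Z :: (real ^ 'n) set.
           0 < s \<longrightarrow> s \<le> 1 \<longrightarrow> 0 < h \<longrightarrow> h_dense h s Z \<longrightarrow> Z \<subseteq> cball 0 (1/3) \<longrightarrow>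
           h \<le> \<xi> * s ^ (CARD('n) * (d + 1)) \<longrightarrow> rigidity d Z \<ge> M"
proof -
  let ?N = "real CARD('n)"
  from deriv_norm_cube_bound[of "d + 1", where 'n = 'n]
  obtain K where K: "0 \<le> K" "\<forall>f :: real ^ 'n \<Rightarrow> real. \<forall>s h Z.
     C_smooth_on (d + 1) (cball 0 1) f \<longrightarrow> 1 \<le> d + 1 \<longrightarrow> 0 < s \<longrightarrow> s \<le> 1 \<longrightarrow> 0 < h \<longrightarrow> h \<le> s \<longrightarrow>
     (cube s :: (real ^ 'n) set) \<subseteq> cball 0 1 \<longrightarrow>
     h_dense h s Z \<longrightarrow> (\<forall>z\<in>Z. f z = 0) \<longrightarrow> h * (2 * ?N * (K + 1)) \<le> s \<longrightarrow>
     (\<forall>k\<le>d + 1. deriv_norm k f 0 \<le> (K + 1) * M_norm (d + 1) f)"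
    by (elim exE conjE) (rule that)
  \<comment> \<open>\<open>\<xi>\<close> makes \<open>h \<le> \<xi> * s\<close> the smallness
    condition on \<open>h\<close>; \<open>M\<close> is the reciprocal of the constant that bounds
    \<open>M_norm 0 f\<close> by \<open>M_norm (d + 1) f\<close>.\<close>
  define \<xi> where "\<xi> = 1 / (2 * ?N * (K + 1))"
  define M where "M = 1 / ((K + 1) * (?N + 1) ^ (d + 1))"
  have N: "?N \<ge> 1" by (simp add: Suc_leI)
  have NK: "1 \<le> ?N * (K + 1)" using mult_mono[of 1 ?N 1 "K + 1"] N K(1) by simp
  have pos: "0 < \<xi>" "0 < M" using K(1) N by (auto simp: \<xi>_def M_def)
  show ?thesis
  proof (rule exI[of _ \<xi>], rule conjI[OF pos(1)], rule exI[of _ M], rule conjI[OF pos(2)],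
      intro allI impI)
    fix s h :: real and Z :: "(real ^ 'n) set"
    assume s: "0 < s" "s \<le> 1" and h0: "0 < h" and Z: "h_dense h s Z" "Z \<subseteq> cball 0 (1/3)"
      and h: "h \<le> \<xi> * s ^ (CARD('n) * (d + 1))"
    \<comment> \<open>The exponent is at least 1 and \<open>s \<le> 1\<close>, so the hypothesis on
      \<open>h\<close> bounds the ratio \<open>h / s\<close> by \<open>\<xi>\<close>.\<close>
    have "s ^ (CARD('n) * (d + 1)) \<le> s ^ 1"
      using s by (intro power_decreasing) (auto simp: Suc_leI)
    then have "h \<le> \<xi> * s"
      using h pos(1) by (metis mult_left_mono less_imp_le order_trans power_one_right)
    then have hs: "h * (2 * ?N * (K + 1)) \<le> s"
      using NK by (simp add: \<xi>_def field_simps)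
    have "h * 2 \<le> h * (2 * ?N * (K + 1))" using NK h0 by (intro mult_left_mono) auto
    from this hs have "h * 2 \<le> s" by (rule order_trans)
    then have h2: "h \<le> s / 2" by simp
    have Q: "(cube s :: (real ^ 'n) set) \<subseteq> cball 0 1" by (rule cube_subset_cball[OF Z h0 h2])
    show "M \<le> rigidity d Z"
      unfolding rigidity_def
    proof (rule cINF_greatest)
      show "U_class d Z \<noteq> {}" using Z(1) by (intro U_class_nonempty) (simp add: h_dense_def)
      fix f assume "f \<in> U_class d Z"
      then have f: "C_smooth_on (d + 1) (cball 0 1) f" "\<And>z. z \<in> Z \<Longrightarrow> f z = 0" "M_norm 0 f = 1"
        by (auto simp: U_class_def)
      have "deriv_norm k f 0 \<le> (K + 1) * M_norm (d + 1) f" if "k \<le> d + 1" for k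
        by (rule K(2)[rule_format, OF f(1) _ s h0 _ Q Z(1) f(2) hs that]) (use h2 s in auto)
      \<comment> \<open>Taking \<open>j = m = d + 1\<close> descends all the way to order 0, where
        the normalisation \<open>M_norm 0 f = 1\<close> applies.\<close>
      from deriv_norm_ball_bound[OF f(1) _ this le_refl] K(1)
      have "deriv_norm 0 f x \<le> (K + 1) * (?N + 1) ^ (d + 1) * M_norm (d + 1) f" if "x \<in> cball 0 1" for x
        using that by (simp only: diff_self_eq_0 le_add_same_cancel2)
      then have "M_norm 0 f \<le> (K + 1) * (?N + 1) ^ (d + 1) * M_norm (d + 1) f"
        unfolding M_norm_def[of 0] by (intro cSUP_least) auto
      moreover have "0 < (K + 1) * (?N + 1) ^ (d + 1)" using K(1) N by simp
      ultimately show "M \<le> M_norm (d + 1) f"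
        using f(3) by (simp add: M_def field_simps)
    qed
  qed
qed

end
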